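(* Let $S$ and $V$ be nonzero finite dimensional subspaces of $H$ with $S\perp V$. Let $m\in\mathbb{N}$ be such that (after reordering the basis $E$) $\{(T_n,L_n)\}_{n=1}^m$ is a basis of the real span of $\{(T_n,L_n)\}_{n\in\mathbb{N}}$ in $\mathcal{B}_S^h\oplus\mathcal{B}_V^h$. Then the following statements are equivalent. (1) There exists a nonzero $(X,Y)\in\mathcal{B}_S^+\oplus\mathcal{B}_V^+$ with $\operatorname{tr}(X)=\operatorname{tr}(Y)=1$ and $(X,Y)\in\ker(\Delta)$. (2) There exists a nonzero $(X,Y)\in\mathcal{B}_S^+\oplus\mathcal{B}_V^+$ with $\operatorname{tr}(X)=\operatorname{tr}(Y)=1$ and $(X,-Y)\perp(T_n,L_n)$ for all $n=1,\dots,m$. (3) There exists a nonzero $(X,Y)\in\mathcal{B}_S^+\oplus\mathcal{B}_V^+$ with $\operatorname{tr}(X)=\operatorname{tr}(Y)=1$ and $(X,-Y)\perp(T_n,L_n)$ for all $n\in\mathbb{N}$. (4) There exists a nonzero $(X,Y)\in\mathcal{B}_S^+\oplus\mathcal{B}_V^+$ with $\operatorname{tr}(X)=\operatorname{tr}(Y)=1$ and $X_{n,n}=Y_{n,n}$ for $n=1,\dots,m$. (5) There exists a nonzero $(X,Y)\in\mathcal{B}_S^+\oplus\mathcal{B}_V^+$ with $\operatorname{tr}(X)=\operatorname{tr}(Y)=1$ and $\operatorname{Diag}(X)=\operatorname{Diag}(Y)$. (6) $m_S\cap m_V\neq\emptyset$. (7) $W(P_SE_1P_S,\dots,P_SE_iP_S,\dots)\cap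 W(P_VE_1P_V,\dots,P_VE_jP_V,\dots)\neq\{0\}$. (8) $W(P_SE_1P_S,\dots,P_SE_mP_S)\cap W(P_VE_1P_V,\dots,P_VE_mP_V)\neq\{0\}$.
   Context: $H$ is a complex separable infinite dimensional Hilbert space with a fixed orthonormal basis $E=\{e_j\}_{j=1}^\infty$; $E_j=e_j\otimes e_j$ is the rank-one orthogonal projection onto $\mathrm{span}\{e_j\}$; $P_S$ is the orthogonal projection onto $S$; $X_{n,n}=\langle Xe_n,e_n\rangle$; $\operatorname{Diag}(X)$ is the diagonal operator with the same diagonal as $X$ in the basis $E$. $\mathcal{B}_1(H)$ is the space of trace-class operators. $\mathcal{D}_S=\{Y\in\mathcal{B}_1(H):P_SY=Y\ge0,\ \operatorname{tr}(Y)=1\}$ and $m_S=\{(Y_{n,n})_{n\in\mathbb{N}}:Y\in\mathcal{D}_S\}$. $\mathcal{B}_S^h$ is the real vector space of self-adjoint elements of $\mathcal{B}_S=P_SB(H)P_S$, and $\mathcal{B}_S^+$ is the set of its positive semidefinite elements; likewise for $V$. $\mathcal{B}_S^h\oplus\mathcal{B}_V^h$ is the space of pairs with inner product $\langle(A,C),(A',C')\rangle=\operatorname{tr}(AA')+\operatorname{tr}(CC')$, and $\perp$ refers to it. $\Delta(A,C)=\operatorname{Diag}(A)-\operatorname{Diag}(C)$ for $(A,C)\in\mathcal{B}_S^h\oplus\mathcal{B}_V^h$. $T_n\in\mathcal{B}_S^h$ is the operator with $\operatorname{tr}(AT_n)=A_{n,n}$ for all $A\in\mathcal{B}_S^h$,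 and $L_n\in\mathcal{B}_V^h$ is the operator with $\operatorname{tr}(CL_n)=C_{n,n}$ for all $C\in\mathcal{B}_V^h$. For a finite or infinite norm-bounded sequence $\mathbf{A}=\{A_j\}$ of self-adjoint compact operators on $H$, $W(\mathbf{A})=\{\{\operatorname{tr}(\rho A_j)\}_j:\rho\in\mathcal{B}_1(H),\ \rho\ge0,\ \operatorname{tr}(\rho)=1\}$. *)

theory Defs
  imports "HOL-Analysis.Analysis"
begin

(* The underlying real inner product is the real part of the complex one, so norm, topology
   and completeness are those of the library classes. cinner is linear in its first argument. *)
class complex_hilbert = real_inner + complete_space +
  fixes scaleC :: "complex \<Rightarrow> 'a \<Rightarrow> 'a" (infixr "*\<^sub>C" 75)
    and cinner :: "'a \<Rightarrow> 'a \<Rightarrow> complex"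
  assumes scaleC_add_right: "c *\<^sub>C (x + y) = c *\<^sub>C x + c *\<^sub>C y"
    and scaleC_add_left: "(c + d) *\<^sub>C x = c *\<^sub>C x + d *\<^sub>C x"
    and scaleC_scaleC: "c *\<^sub>C (d *\<^sub>C x) = (c * d) *\<^sub>C x"
    and scaleR_scaleC: "scaleR r x = complex_of_real r *\<^sub>C x"
    and cinner_commute: "cinner x y = cnj (cinner y x)"
    and cinner_add_left: "cinner (x + y) z = cinner x z + cinner y z"
    and cinner_scaleC_left: "cinner (c *\<^sub>C x) y = c * cinner x y"
    and Re_cinner: "Re (cinner x y) = inner x y"

global_interpretation complex_vector: vector_space "scaleC :: complex \<Rightarrow> 'a \<Rightarrow> 'a::complex_hilbert"
proof
  fix c d :: complex and x y :: 'a
  show "1 *\<^sub>C x = x"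
    using scaleR_scaleC[of 1 x] by simp
qed (simp_all add: scaleC_add_right scaleC_add_left scaleC_scaleC)

definition fin_dim_subspace :: "'a::complex_hilbert set \<Rightarrow> bool" where
  "fin_dim_subspace S \<longleftrightarrow> (\<exists>B. finite B \<and> complex_vector.span B = S)"

(* An orthonormal basis indexed by nat (counted from 0); its existence makes the space
   separable and infinite dimensional. *)
definition orthonormal_basis :: "(nat \<Rightarrow> 'a::complex_hilbert) \<Rightarrow> bool" where
  "orthonormal_basis e \<longleftrightarrow>
     (\<forall>i j. cinner (e i) (e j) = (if i = j then 1 else 0)) \<and>
     closure (complex_vector.span (range e)) = UNIV"

(* B(H): blinfun only provides real linearity. *)
definition bop :: "('a::complex_hilbert \<Rightarrow>\<^sub>L 'a) set" where
  "bop = {A :: 'a \<Rightarrow>\<^sub>L 'a. \<forall>c x. A (c *\<^sub>C x) = c *\<^sub>C A x}"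

definition selfadjoint :: "('a::complex_hilbert \<Rightarrow>\<^sub>L 'a) \<Rightarrow> bool" where
  "selfadjoint A \<longleftrightarrow> A \<in> bop \<and> (\<forall>x y. cinner (A x) y = cinner x (A y))"

definition positive_op :: "('a::complex_hilbert \<Rightarrow>\<^sub>L 'a) \<Rightarrow> bool" where
  "positive_op A \<longleftrightarrow> A \<in> bop \<and> (\<forall>x. cinner (A x) x \<in> \<real>\<^sub>\<ge>\<^sub>0)"

definition proj :: "'a::complex_hilbert set \<Rightarrow> 'a \<Rightarrow>\<^sub>L 'a" where
  "proj S = (THE P :: 'a \<Rightarrow>\<^sub>L 'a. \<forall>x. P x \<in> S \<and> (\<forall>y\<in>S. cinner (x - P x) y = 0))"

definition rank_one :: "'a::complex_hilbert \<Rightarrow> 'a \<Rightarrow> 'a \<Rightarrow>\<^sub>L 'a" where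
  "rank_one x y = Blinfun (\<lambda>z. cinner z y *\<^sub>C x)"

definition diag_entry :: "(nat \<Rightarrow> 'a::complex_hilbert) \<Rightarrow> ('a \<Rightarrow>\<^sub>L 'a) \<Rightarrow> nat \<Rightarrow> complex" where
  "diag_entry e X n = cinner (X (e n)) (e n)"

definition Diag :: "(nat \<Rightarrow> 'a::complex_hilbert) \<Rightarrow> ('a \<Rightarrow>\<^sub>L 'a) \<Rightarrow> 'a \<Rightarrow>\<^sub>L 'a" where
  "Diag e X = (THE D. D \<in> bop \<and> (\<forall>n. D (e n) = diag_entry e X n *\<^sub>C e n))"

definition is_cadjoint :: "('a::complex_hilbert \<Rightarrow>\<^sub>L 'a) \<Rightarrow> ('a \<Rightarrow>\<^sub>L 'a) \<Rightarrow> bool" where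
  "is_cadjoint A B \<longleftrightarrow> A \<in> bop \<and> B \<in> bop \<and> (\<forall>x y. cinner (A x) y = cinner x (B y))"

(* The P below is the absolute value of A, the unique positive square root of B o A with B
   the adjoint of A; A is trace class iff the trace of its absolute value is finite. *)
definition trace_class :: "(nat \<Rightarrow> 'a::complex_hilbert) \<Rightarrow> ('a \<Rightarrow>\<^sub>L 'a) set" where
  "trace_class e = {A. \<exists>B P. is_cadjoint A B \<and> positive_op P \<and> P o\<^sub>L P = B o\<^sub>L A \<and>
                         diag_entry e P summable_on UNIV}"

(* Only meaningful on trace-class operators; infsum is 0 on non-summable families. *)
definition tr :: "(nat \<Rightarrow> 'a::complex_hilbert) \<Rightarrow> ('a \<Rightarrow>\<^sub>L 'a) \<Rightarrow> complex" where
  "tr e A = (\<Sum>\<^sub>\<infinity>n. diag_entry e A n)"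

definition density_set :: "(nat \<Rightarrow> 'a::complex_hilbert) \<Rightarrow> 'a set \<Rightarrow> ('a \<Rightarrow>\<^sub>L 'a) set" where
  "density_set e S = {Y \<in> trace_class e. proj S o\<^sub>L Y = Y \<and> positive_op Y \<and> tr e Y = 1}"

definition moment_set :: "(nat \<Rightarrow> 'a::complex_hilbert) \<Rightarrow> 'a set \<Rightarrow> (nat \<Rightarrow> complex) set" where
  "moment_set e S = diag_entry e ` density_set e S"

definition B_sub :: "'a::complex_hilbert set \<Rightarrow> ('a \<Rightarrow>\<^sub>L 'a) set" where
  "B_sub S = (\<lambda>A. proj S o\<^sub>L A o\<^sub>L proj S) ` bop"

definition Bh :: "'a::complex_hilbert set \<Rightarrow> ('a \<Rightarrow>\<^sub>L 'a) set" where
  "Bh S = {A \<in> B_sub S. selfadjoint A}"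

definition Bplus :: "'a::complex_hilbert set \<Rightarrow> ('a \<Rightarrow>\<^sub>L 'a) set" where
  "Bplus S = {A \<in> B_sub S. positive_op A}"

fun pair_inner :: "(nat \<Rightarrow> 'a::complex_hilbert) \<Rightarrow>
    ('a \<Rightarrow>\<^sub>L 'a) \<times> ('a \<Rightarrow>\<^sub>L 'a) \<Rightarrow> ('a \<Rightarrow>\<^sub>L 'a) \<times> ('a \<Rightarrow>\<^sub>L 'a) \<Rightarrow> complex" where
  "pair_inner e (A, C) (A', C') = tr e (A o\<^sub>L A') + tr e (C o\<^sub>L C')"

definition perp :: "(nat \<Rightarrow> 'a::complex_hilbert) \<Rightarrow>
    ('a \<Rightarrow>\<^sub>L 'a) \<times> ('a \<Rightarrow>\<^sub>L 'a) \<Rightarrow> ('a \<Rightarrow>\<^sub>L 'a) \<times> ('a \<Rightarrow>\<^sub>L 'a) \<Rightarrow> bool" where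
  "perp e p q \<longleftrightarrow> pair_inner e p q = 0"

fun Delta :: "(nat \<Rightarrow> 'a::complex_hilbert) \<Rightarrow> ('a \<Rightarrow>\<^sub>L 'a) \<times> ('a \<Rightarrow>\<^sub>L 'a) \<Rightarrow> 'a \<Rightarrow>\<^sub>L 'a" where
  "Delta e (A, C) = Diag e A - Diag e C"

definition ker_Delta :: "(nat \<Rightarrow> 'a::complex_hilbert) \<Rightarrow> 'a set \<Rightarrow> 'a set \<Rightarrow>
    (('a \<Rightarrow>\<^sub>L 'a) \<times> ('a \<Rightarrow>\<^sub>L 'a)) set" where
  "ker_Delta e S V = {p \<in> Bh S \<times> Bh V. Delta e p = 0}"

(* T_n is entry_op e S n and L_n is entry_op e V n. *)
definition entry_op :: "(nat \<Rightarrow> 'a::complex_hilbert) \<Rightarrow> 'a set \<Rightarrow> nat \<Rightarrow> 'a \<Rightarrow>\<^sub>L 'a" where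
  "entry_op e S n = (THE T. T \<in> Bh S \<and> (\<forall>A\<in>Bh S. tr e (A o\<^sub>L T) = diag_entry e A n))"

(* The joint numerical range of the family (A j), j in J; sequences indexed by J are functions
   that are undefined off J, and the zero sequence is \<lambda>j\<in>J. 0. *)
definition joint_range :: "(nat \<Rightarrow> 'a::complex_hilbert) \<Rightarrow> nat set \<Rightarrow> (nat \<Rightarrow> 'a \<Rightarrow>\<^sub>L 'a) \<Rightarrow>
    (nat \<Rightarrow> complex) set" where
  "joint_range e J A =
     {(\<lambda>j\<in>J. tr e (\<rho> o\<^sub>L A j)) | \<rho>. \<rho> \<in> trace_class e \<and> positive_op \<rho> \<and> tr e \<rho> = 1}"

definition compressed :: "(nat \<Rightarrow> 'a::complex_hilbert) \<Rightarrow> 'a set \<Rightarrow> nat \<Rightarrow> 'a \<Rightarrow>\<^sub>L 'a" where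
  "compressed e S j = proj S o\<^sub>L rank_one (e j) (e j) o\<^sub>L proj S"

definition all_equivalent :: "bool list \<Rightarrow> bool" where
  "all_equivalent ps \<longleftrightarrow> (\<forall>p\<in>set ps. \<forall>q\<in>set ps. p \<longleftrightarrow> q)"

end

theory Submission
  imports Defs
begin

text \<open>All eight conditions say that there are density operators \<open>X\<close> on \<open>S\<close> and \<open>Y\<close> on \<open>V\<close> with the
  same diagonal; each condition is compared with this one.

  The operators \<open>T\<^sub>n\<close> and \<open>L\<^sub>n\<close> are the compressions \<open>P\<^sub>S E\<^sub>n P\<^sub>S\<close> and \<open>P\<^sub>V E\<^sub>n P\<^sub>V\<close>
  (\<open>entry_op_eq_compressed\<close>), so orthogonality of \<open>(X, -Y)\<close> to \<open>(T\<^sub>n, L\<^sub>n)\<close> is the equation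
  \<open>X\<^sub>n\<^sub>n = Y\<^sub>n\<^sub>n\<close>. Orthogonality is linear in the pair, hence the equations for a spanning initial
  segment imply all of them (\<open>diag_entry_eq_if_eq_on_spanning\<close>). Operators supported on a
  finite-dimensional subspace have absolutely summable diagonals and a trace given by a finite sum.
  This makes the density operators on \<open>S\<close> trace class, lets the trace be handled as a linear
  functional, and gives the existence of \<open>Diag(X)\<close>, which therefore determines the diagonal of
  \<open>X\<close> (\<open>Diag_eq_iff\<close>).

  For the joint numerical ranges, \<open>tr(\<rho> P\<^sub>S E\<^sub>j P\<^sub>S)\<close> is the \<open>j\<close>-th diagonal entry of the
  compression \<open>P\<^sub>S \<rho> P\<^sub>S\<close>, a positive operator on \<open>S\<close> whose trace may be smaller than one. Since
  \<open>S \<perp> V\<close> and both are nonzero, the zero family belongs to both ranges: a vector state on one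
  subspace compresses to zero on the other. So the intersection differs from \<open>{0}\<close> exactly if it
  has a nonzero element, and a nonzero common element yields compressions with equal diagonals, hence
  with equal positive traces, that can be normalized simultaneously
  (\<open>joint_ranges_meet_iff\<close>).\<close>

text \<open>Completeness of the space passes to the bounded operators, where the series defining the diagonal
  operator is summed.\<close>

instance complex_hilbert \<subseteq> banach ..

section \<open>The complex inner product\<close>

lemma cinner_add_right: "cinner x (y + z) = cinner x y + cinner x z"
  by (metis cinner_add_left cinner_commute complex_cnj_add)

lemma cinner_scaleC_right: "cinner x (c *\<^sub>C y) = cnj c * cinner x y"
  by (metis cinner_commute cinner_scaleC_left complex_cnj_mult)

lemma cinner_zero_left [simp]: "cinner 0 x = 0"
  using cinner_add_left[of 0 0 x] by simp

lemma cinner_zero_right [simp]: "cinner x 0 = 0"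
  using cinner_add_right[of x 0 0] by simp

lemma cinner_minus_left: "cinner (- x) y = - cinner x y"
  using cinner_add_left[of x "- x" y] by (simp add: add_eq_0_iff)

lemma cinner_minus_right: "cinner x (- y) = - cinner x y"
  using cinner_add_right[of x y "- y"] by (simp add: add_eq_0_iff)

lemma cinner_diff_left: "cinner (x - y) z = cinner x z - cinner y z"
  using cinner_add_left[of x "- y" z] by (simp add: cinner_minus_left)

lemma cinner_diff_right: "cinner x (y - z) = cinner x y - cinner x z"
  using cinner_add_right[of x y "- z"] by (simp add: cinner_minus_right)

lemma cinner_sum_left: "cinner (\<Sum>i\<in>A. f i) y = (\<Sum>i\<in>A. cinner (f i) y)"
  by (induction A rule: infinite_finite_induct) (simp_all add: cinner_add_left)

lemma cinner_scaleR_left: "cinner (r *\<^sub>R x) y = of_real r * cinner x y"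
  by (simp add: scaleR_scaleC cinner_scaleC_left)

lemma cinner_self: "cinner x x = of_real ((norm x)\<^sup>2)"
proof -
  have "Im (cinner x x) = 0"
    using arg_cong[OF cinner_commute[of x x], of Im] by simp
  then show ?thesis
    by (simp add: complex_eq_iff Re_cinner power2_norm_eq_inner)
qed

lemma cinner_self_eq_0: "cinner x x = 0 \<longleftrightarrow> x = 0"
  by (simp add: cinner_self)

lemma norm_scaleC: "norm (c *\<^sub>C x) = cmod c * norm x"
proof -
  have "complex_of_real ((norm (c *\<^sub>C x))\<^sup>2) = (c * cnj c) * complex_of_real ((norm x)\<^sup>2)"
    by (simp only: cinner_self[symmetric] cinner_scaleC_left cinner_scaleC_right mult_ac)
  also have "\<dots> = complex_of_real ((cmod c * norm x)\<^sup>2)"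
    by (simp only: complex_norm_square[symmetric] power_mult_distrib of_real_mult)
  finally have "(norm (c *\<^sub>C x))\<^sup>2 = (cmod c * norm x)\<^sup>2"
    by (simp only: of_real_eq_iff)
  then show ?thesis
    by (simp add: power2_eq_iff_nonneg)
qed

text \<open>Multiplying the first argument by a unit complex number makes the complex inner product
  real, so that the real Cauchy--Schwarz inequality applies.\<close>

lemma norm_cinner_le: "cmod (cinner x y) \<le> norm x * norm y"
proof (cases "cinner x y = 0")
  case False
  define u where "u = cnj (sgn (cinner x y))"
  have u: "cmod u = 1"
    using False by (simp add: u_def norm_sgn)
  have "u * cinner x y = of_real (cmod (cinner x y))"
    using False unfolding u_def sgn_eq
    by (simp add: complex_norm_square[symmetric] power2_eq_square mult.commute)
  then have "cmod (cinner x y) = inner (u *\<^sub>C x) y"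
    by (simp flip: Re_cinner add: cinner_scaleC_left)
  also have "\<dots> \<le> norm (u *\<^sub>C x) * norm y"
    by (rule norm_cauchy_schwarz)
  finally show ?thesis
    by (simp add: norm_scaleC u)
qed simp

lemma bounded_linear_cinner_left: "bounded_linear (\<lambda>x. cinner x y)"
  by (rule bounded_linear_intro[where K = "norm y"])
     (simp_all add: cinner_add_left cinner_scaleR_left scaleR_conv_of_real norm_cinner_le)

lemma bounded_linear_scaleC_left: "bounded_linear (\<lambda>c. c *\<^sub>C x)"
  by (rule bounded_linear_intro[where K = "norm x"])
     (simp_all add: scaleC_add_left scaleR_scaleC scaleR_conv_of_real scaleC_scaleC norm_scaleC)

lemma bounded_linear_scaleC_right: "bounded_linear (\<lambda>x. c *\<^sub>C x)"
  by (rule bounded_linear_intro[where K = "cmod c"])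
     (simp_all add: scaleC_add_right scaleR_scaleC scaleC_scaleC norm_scaleC mult_ac)

lemma rank_one_apply: "rank_one x y z = cinner z y *\<^sub>C x"
proof -
  have "bounded_linear (\<lambda>z. cinner z y *\<^sub>C x)"
    by (rule bounded_linear_compose[OF bounded_linear_scaleC_left bounded_linear_cinner_left])
  then show ?thesis
    by (simp add: rank_one_def bounded_linear_Blinfun_apply)
qed

section \<open>Bounded complex-linear operators\<close>

lemma bop_scaleC: "A \<in> bop \<Longrightarrow> A (c *\<^sub>C x) = c *\<^sub>C A x"
  by (simp add: bop_def)

lemma bop_compose: "A \<in> bop \<Longrightarrow> B \<in> bop \<Longrightarrow> A o\<^sub>L B \<in> bop"
  by (simp add: bop_def)

lemma bop_diff: "A \<in> bop \<Longrightarrow> B \<in> bop \<Longrightarrow> A - B \<in> bop"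
  by (simp add: bop_def blinfun.diff_left complex_vector.scale_right_diff_distrib)

lemma rank_one_in_bop: "rank_one x y \<in> bop"
  by (simp add: bop_def rank_one_apply cinner_scaleC_left scaleC_scaleC)

lemma selfadjointD: "selfadjoint A \<Longrightarrow> cinner (A x) y = cinner x (A y)"
  by (simp add: selfadjoint_def)

text \<open>Polarization: the sesquilinear form that measures the failure of self-adjointness vanishes on
  the diagonal, hence is both antisymmetric and, after replacing \<open>x\<close> by \<open>\<i> x\<close>, symmetric.\<close>

lemma positive_op_imp_selfadjoint:
  assumes "positive_op A"
  shows "selfadjoint A"
proof -
  have A: "A \<in> bop"
    using assms by (simp add: positive_op_def)
  define q where "q x y = cinner (A x) y - cinner x (A y)" for x y
  have q0: "q x x = 0" for x
  proof -
    have "cnj (cinner (A x) x) = cinner (A x) x"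
      using assms by (metis Reals_cnj_iff nonneg_Reals_subset_Reals positive_op_def subset_iff)
    then show ?thesis
      unfolding q_def using cinner_commute[of x "A x"] by simp
  qed
  have q_add: "q (x + y) (x + y) = q x x + q x y + q y x + q y y" for x y
    by (simp add: q_def blinfun.add_right cinner_add_left cinner_add_right)
  have anti: "q x y + q y x = 0" for x y
    using q_add[of x y] by (simp add: q0)
  have q_scale: "q (\<i> *\<^sub>C x) y = \<i> * q x y" "q y (\<i> *\<^sub>C x) = - \<i> * q y x" for x y
    by (simp_all add: q_def bop_scaleC[OF A] cinner_scaleC_left cinner_scaleC_right algebra_simps)
  have "q x y = 0" for x y
  proof -
    have "\<i> * (q x y - q y x) = 0"
      using anti[of "\<i> *\<^sub>C x" y] by (simp add: q_scale algebra_simps)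
    then show ?thesis
      using anti[of x y] by simp
  qed
  then show ?thesis
    using A by (simp add: selfadjoint_def q_def)
qed

lemma selfadjoint_eq_0:
  assumes "selfadjoint D" and "\<And>x. cinner (D x) x = 0"
  shows "D = 0"
proof (rule blinfun_eqI)
  fix x
  let ?y = "D x"
  have "cinner (D (x + ?y)) (x + ?y) = 0"
    by (rule assms)
  then have "cinner ?y ?y + cinner (D ?y) x = 0"
    by (simp add: blinfun.add_right cinner_add_left cinner_add_right assms(2) add.commute)
  moreover have "cinner (D ?y) x = cinner ?y ?y"
    using assms(1) by (rule selfadjointD)
  ultimately show "D x = blinfun_apply 0 x"
    by (simp add: cinner_self_eq_0)
qed

section \<open>Finite orthonormal sets and projections\<close>

definition orthonormal_set :: "'a::complex_hilbert set \<Rightarrow> bool" where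
  "orthonormal_set F \<longleftrightarrow> (\<forall>f\<in>F. \<forall>g\<in>F. cinner f g = (if f = g then 1 else 0))"

text \<open>The orthogonal projection onto the span of \<open>F\<close>, if \<open>F\<close> is finite and orthonormal.\<close>

definition fourier_sum :: "'a::complex_hilbert set \<Rightarrow> 'a \<Rightarrow> 'a" where
  "fourier_sum F x = (\<Sum>f\<in>F. cinner x f *\<^sub>C f)"

lemma fourier_sum_in_span: "fourier_sum F x \<in> complex_vector.span F"
  unfolding fourier_sum_def
  by (intro complex_vector.span_sum complex_vector.span_scale complex_vector.span_base)

lemma fourier_sum_scaleC: "fourier_sum F (c *\<^sub>C x) = c *\<^sub>C fourier_sum F x"
  by (simp add: fourier_sum_def cinner_scaleC_left scaleC_scaleC complex_vector.scale_sum_right)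

lemma bounded_linear_fourier_sum: "bounded_linear (fourier_sum F)"
  unfolding fourier_sum_def
  by (intro bounded_linear_sum
      bounded_linear_compose[OF bounded_linear_scaleC_left bounded_linear_cinner_left])

lemma cinner_span_eq_0:
  assumes "\<And>f. f \<in> F \<Longrightarrow> cinner x f = 0" and "y \<in> complex_vector.span F"
  shows "cinner x y = 0"
  using assms(2)
  by (induction rule: complex_vector.span_induct_alt)
     (simp_all add: cinner_add_right cinner_scaleC_right assms(1))

lemma fourier_sum_orthogonal:
  assumes "finite F" and "orthonormal_set F" and "y \<in> complex_vector.span F"
  shows "cinner (x - fourier_sum F x) y = 0"
proof (rule cinner_span_eq_0[OF _ assms(3)])
  fix g assume g: "g \<in> F"
  have "cinner (fourier_sum F x) g = (\<Sum>f\<in>F. cinner x f * (if f = g then 1 else 0))"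
    unfolding fourier_sum_def cinner_sum_left cinner_scaleC_left
    using assms(2) g by (intro sum.cong) (auto simp: orthonormal_set_def)
  also have "\<dots> = cinner x g"
    using assms(1) g by (simp add: if_distrib cong: if_cong)
  finally show "cinner (x - fourier_sum F x) g = 0"
    by (simp add: cinner_diff_left)
qed

lemma fourier_sum_id:
  assumes "finite F" and "orthonormal_set F" and "x \<in> complex_vector.span F"
  shows "fourier_sum F x = x"
proof -
  have "x - fourier_sum F x \<in> complex_vector.span F"
    by (intro complex_vector.span_diff assms fourier_sum_in_span)
  from fourier_sum_orthogonal[OF assms(1,2) this, of x] show ?thesis
    by (simp add: cinner_self_eq_0)
qed

text \<open>One Gram--Schmidt step for each vector of a finite spanning set.\<close>

lemma ex_orthonormal_set_span:
  assumes "finite B"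
  shows "\<exists>F. finite F \<and> orthonormal_set F \<and> complex_vector.span F = complex_vector.span B"
  using assms
proof (induction B)
  case empty
  show ?case
    by (intro exI[of _ "{}"]) (simp add: orthonormal_set_def)
next
  case (insert b B)
  then obtain F where F: "finite F" "orthonormal_set F"
      "complex_vector.span F = complex_vector.span B"
    by blast
  define w where "w = b - fourier_sum F b"
  have b: "b = fourier_sum F b + w"
    by (simp add: w_def)
  show ?case
  proof (cases "w = 0")
    case True
    then have "b \<in> complex_vector.span B"
      using b F(3) fourier_sum_in_span[of F b] by simp
    then show ?thesis
      using F complex_vector.span_redundant by blast
  next
    case False
    define u where "u = complex_of_real (1 / norm w) *\<^sub>C w"
    have w: "w = complex_of_real (norm w) *\<^sub>C u"
      using False by (simp add: u_def scaleC_scaleC)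
    have uu: "cinner u u = 1"
      using False by (simp add: cinner_self u_def norm_scaleC norm_divide)
    have uf: "cinner u f = 0" if "f \<in> F" for f
      using fourier_sum_orthogonal[OF F(1,2), of f b] that
      by (simp add: u_def w_def cinner_scaleC_left complex_vector.span_base)
    have fu: "cinner f u = 0" if "f \<in> F" for f
      using uf[OF that] by (metis cinner_commute complex_cnj_zero)
    have "orthonormal_set (insert u F)"
      using F(2) uu uf fu by (auto simp: orthonormal_set_def)
    moreover have "complex_vector.span (insert u F) = complex_vector.span (insert b B)"
    proof -
      have F_sub: "F \<subseteq> complex_vector.span (insert b B)"
        using F(3) complex_vector.span_superset[of F]
          complex_vector.span_mono[of B "insert b B"] by blast
      have p: "fourier_sum F b \<in> complex_vector.span (insert b B)"
        using fourier_sum_in_span[of F b] F(3)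
          complex_vector.span_mono[of B "insert b B"] by blast
      have "u \<in> complex_vector.span (insert b B)"
        unfolding u_def w_def
        by (intro complex_vector.span_scale complex_vector.span_diff p complex_vector.span_base) simp
      moreover have "b \<in> complex_vector.span (insert u F)"
      proof (subst b, rule complex_vector.span_add)
        show "fourier_sum F b \<in> complex_vector.span (insert u F)"
          using fourier_sum_in_span[of F b] complex_vector.span_mono[of F "insert u F"] by blast
        show "w \<in> complex_vector.span (insert u F)"
          by (subst w, intro complex_vector.span_scale complex_vector.span_base) simp
      qed
      moreover have "B \<subseteq> complex_vector.span (insert u F)"
        using F(3) complex_vector.span_superset[of B]
          complex_vector.span_mono[of F "insert u F"] by blast
      ultimately show ?thesis
        using F_sub by (simp add: complex_vector.span_eq)
    qed
    ultimately show ?thesis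
      using F(1) by blast
  qed
qed

text \<open>The Fourier sum satisfies the description of \<open>proj\<close>, and two operators satisfying it differ at
  each point by a vector that lies in the subspace and is orthogonal to it.\<close>

lemma proj_eq_fourier_sum:
  assumes "finite F" and "orthonormal_set F"
  shows "proj (complex_vector.span F) x = fourier_sum F x"
proof -
  let ?S = "complex_vector.span F"
  let ?Q = "\<lambda>P :: 'a \<Rightarrow>\<^sub>L 'a. \<forall>x. P x \<in> ?S \<and> (\<forall>y\<in>?S. cinner (x - P x) y = 0)"
  define P where "P = Blinfun (fourier_sum F)"
  have P: "blinfun_apply P = fourier_sum F"
    by (simp add: P_def bounded_linear_Blinfun_apply bounded_linear_fourier_sum)
  have "?Q P"
    by (simp add: P fourier_sum_in_span fourier_sum_orthogonal[OF assms])
  moreover have "P' = P" if "?Q P'" for P'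
  proof (rule blinfun_eqI)
    fix x
    let ?d = "P x - P' x"
    have "P x \<in> ?S" "P' x \<in> ?S"
      using that \<open>?Q P\<close> by blast+
    then have d: "?d \<in> ?S"
      by (rule complex_vector.span_diff)
    have "cinner (x - P' x) ?d = 0" "cinner (x - P x) ?d = 0"
      using that \<open>?Q P\<close> d by blast+
    then have "cinner ?d ?d = 0"
      by (simp only: cinner_diff_left diff_eq_eq diff_self add_0_left)
    then show "P' x = P x"
      by (simp add: cinner_self_eq_0)
  qed
  ultimately have "proj ?S = P"
    unfolding proj_def by (intro the_equality) blast+
  then show ?thesis
    by (simp add: P)
qed

lemma fin_dim_subspace_ex_basis:
  assumes "fin_dim_subspace S"
  shows "\<exists>F. finite F \<and> orthonormal_set F \<and> complex_vector.span F = S \<and>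
              (\<forall>x. proj S x = fourier_sum F x)"
proof -
  obtain B where "finite B" "complex_vector.span B = S"
    using assms by (auto simp: fin_dim_subspace_def)
  then obtain F where F: "finite F" "orthonormal_set F" "complex_vector.span F = S"
    using ex_orthonormal_set_span[of B] by blast
  have "proj S x = fourier_sum F x" for x
    using proj_eq_fourier_sum[OF F(1,2), of x] by (simp only: F(3))
  then show ?thesis
    using F by (intro exI[of _ F]) simp
qed

lemma
  assumes "fin_dim_subspace S"
  shows proj_in_subspace: "proj S x \<in> S"
    and proj_id: "x \<in> S \<Longrightarrow> proj S x = x"
    and proj_orthogonal: "y \<in> S \<Longrightarrow> cinner (x - proj S x) y = 0"
    and proj_in_bop: "proj S \<in> bop"
proof -
  obtain F where F: "finite F" "orthonormal_set F" "complex_vector.span F = S"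
      "\<And>x. proj S x = fourier_sum F x"
    using fin_dim_subspace_ex_basis[OF assms] by blast
  show "proj S x \<in> S"
    using fourier_sum_in_span[of F x] by (simp add: F(3,4))
  show "proj S x = x" if "x \<in> S"
    using fourier_sum_id[OF F(1,2), of x] that by (simp add: F(3,4))
  show "cinner (x - proj S x) y = 0" if "y \<in> S"
    using fourier_sum_orthogonal[OF F(1,2), of y x] that by (simp add: F(3,4))
  show "proj S \<in> bop"
    by (simp add: bop_def F(4) fourier_sum_scaleC)
qed

lemma proj_idem: "fin_dim_subspace S \<Longrightarrow> proj S (proj S x) = proj S x"
  by (simp add: proj_id proj_in_subspace)

lemma cinner_proj:
  assumes "fin_dim_subspace S"
  shows "cinner (proj S x) y = cinner x (proj S y)"
proof -
  have "cinner x (proj S y) = cinner (proj S x) (proj S y)"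
    using proj_orthogonal[OF assms proj_in_subspace[OF assms], of x y]
    by (simp add: cinner_diff_left)
  moreover have "cinner y (proj S x) = cinner (proj S y) (proj S x)"
    using proj_orthogonal[OF assms proj_in_subspace[OF assms], of y x]
    by (simp add: cinner_diff_left)
  ultimately show ?thesis
    by (metis cinner_commute)
qed

section \<open>Expansion in the orthonormal basis\<close>

text \<open>A partial Fourier sum is the best approximation of \<open>x\<close> in the span of the basis vectors used, so
  it is at least as close to \<open>x\<close> as an approximant from the dense algebraic span.\<close>

lemma orthonormal_basis_expansion:
  assumes e: "orthonormal_basis e"
  shows "((\<lambda>n. cinner x (e n) *\<^sub>C e n) has_sum x) UNIV"
proof -
  have ee: "cinner (e i) (e j) = (if i = j then 1 else 0)" for i j
    using e by (simp add: orthonormal_basis_def)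
  have inj: "inj e"
    by (metis ee injI zero_neq_one)
  have image_sum: "(\<Sum>n\<in>G. cinner x (e n) *\<^sub>C e n) = fourier_sum (e ` G) x" for G
    unfolding fourier_sum_def using inj
    by (subst sum.reindex) (auto intro: inj_on_subset)
  have on: "orthonormal_set (e ` G)" for G
    using ee inj by (auto simp: orthonormal_set_def inj_eq)
  show ?thesis
    unfolding has_sum_def tendsto_iff eventually_finite_subsets_at_top
  proof (intro allI impI)
    fix \<epsilon> :: real
    assume "\<epsilon> > 0"
    have "x \<in> closure (complex_vector.span (range e))"
      using e by (simp add: orthonormal_basis_def)
    then obtain y where y: "y \<in> complex_vector.span (range e)" "dist y x < \<epsilon>"
      using \<open>\<epsilon> > 0\<close> closure_approachable by blast
    obtain T a where T: "finite T" "T \<subseteq> range e" and yT: "y = (\<Sum>t\<in>T. a t *\<^sub>C t)"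
      using y(1) unfolding complex_vector.span_explicit by blast
    obtain G0 where G0: "finite G0" "T = e ` G0"
      using finite_subset_image[OF T] by blast
    show "\<exists>X. finite X \<and> X \<subseteq> UNIV \<and> (\<forall>Y. finite Y \<and> X \<subseteq> Y \<and> Y \<subseteq> UNIV \<longrightarrow>
              dist (\<Sum>n\<in>Y. cinner x (e n) *\<^sub>C e n) x < \<epsilon>)"
    proof (intro exI[of _ G0] conjI allI impI G0(1) subset_UNIV)
      fix Y :: "nat set"
      assume Y: "finite Y \<and> G0 \<subseteq> Y \<and> Y \<subseteq> UNIV"
      let ?p = "fourier_sum (e ` Y) x"
      have yY: "y \<in> complex_vector.span (e ` Y)"
        unfolding yT using G0(2) Y
        by (intro complex_vector.span_sum complex_vector.span_scale complex_vector.span_base) auto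
      have "cinner (x - ?p) (?p - y) = 0"
        using Y by (intro fourier_sum_orthogonal on finite_imageI complex_vector.span_diff
            fourier_sum_in_span yY) auto
      then have "inner (x - ?p) (?p - y) = 0"
        by (simp flip: Re_cinner)
      then have "(norm (x - y))\<^sup>2 = (norm (x - ?p))\<^sup>2 + (norm (?p - y))\<^sup>2"
        using norm_add_Pythagorean[of "x - ?p" "?p - y"] by (simp add: orthogonal_def)
      then have "(norm (x - ?p))\<^sup>2 \<le> (norm (x - y))\<^sup>2"
        by simp
      then have "norm (x - ?p) \<le> norm (x - y)"
        by (rule power2_le_imp_le) simp
      then show "dist (\<Sum>n\<in>Y. cinner x (e n) *\<^sub>C e n) x < \<epsilon>"
        using y(2) by (simp add: image_sum dist_norm norm_minus_commute)
    qed
  qed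
qed

lemma trace_rank_one:
  assumes "orthonormal_basis e"
  shows "tr e (rank_one x y) = cinner x y"
proof -
  have "((\<lambda>n. cinner (cinner x (e n) *\<^sub>C e n) y) has_sum cinner x y) UNIV"
    by (rule has_sum_bounded_linear[OF bounded_linear_cinner_left orthonormal_basis_expansion[OF assms],
          unfolded o_def])
  then have "(diag_entry e (rank_one x y) has_sum cinner x y) UNIV"
    unfolding diag_entry_def rank_one_apply cinner_scaleC_left
    by (simp add: cinner_commute[of x] mult.commute)
  then show ?thesis
    unfolding tr_def by (rule infsumI)
qed


section \<open>Operators supported on a finite-dimensional subspace\<close>

lemma B_sub_iff:
  assumes "fin_dim_subspace S"
  shows "A \<in> B_sub S \<longleftrightarrow> A \<in> bop \<and> proj S o\<^sub>L A = A \<and> A o\<^sub>L proj S = A"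
proof
  assume "A \<in> B_sub S"
  then obtain B where B: "B \<in> bop" "A = proj S o\<^sub>L B o\<^sub>L proj S"
    by (auto simp: B_sub_def)
  then show "A \<in> bop \<and> proj S o\<^sub>L A = A \<and> A o\<^sub>L proj S = A"
    using assms by (auto intro!: blinfun_eqI bop_compose proj_in_bop simp: proj_idem)
next
  assume "A \<in> bop \<and> proj S o\<^sub>L A = A \<and> A o\<^sub>L proj S = A"
  then show "A \<in> B_sub S"
    unfolding B_sub_def by (intro image_eqI[of _ _ A]) auto
qed

lemma Bh_imp_bop: "A \<in> Bh S \<Longrightarrow> A \<in> bop"
  by (simp add: Bh_def selfadjoint_def)

lemma Bh_apply:
  assumes "fin_dim_subspace S" and "A \<in> Bh S"
  shows "proj S (A x) = A x" and "A (proj S x) = A x"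
  using assms by (simp_all add: Bh_def B_sub_iff flip: blinfun_apply_blinfun_compose)

lemma Bplus_imp_Bh: "A \<in> Bplus S \<Longrightarrow> A \<in> Bh S"
  by (simp add: Bplus_def Bh_def positive_op_imp_selfadjoint)

text \<open>For a positive operator, taking adjoints turns \<open>P A = A\<close> into \<open>A P = A\<close>. This identifies the
  one-sided support condition of \<open>density_set\<close> with the two-sided one of \<open>B_sub\<close>.\<close>

lemma Bplus_iff:
  assumes "fin_dim_subspace S"
  shows "A \<in> Bplus S \<longleftrightarrow> positive_op A \<and> proj S o\<^sub>L A = A"
proof
  assume A: "positive_op A \<and> proj S o\<^sub>L A = A"
  then have sa: "selfadjoint A" and PA: "\<And>x. proj S (A x) = A x"
    by (simp_all add: positive_op_imp_selfadjoint flip: blinfun_apply_blinfun_compose)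
  have "A o\<^sub>L proj S = A"
  proof (rule blinfun_eqI)
    fix x
    let ?d = "A (proj S x) - A x"
    have "cinner (A (proj S x)) y = cinner (A x) y" for y
      by (simp only: selfadjointD[OF sa] cinner_proj[OF assms] PA)
    then have "cinner ?d ?d = 0"
      by (simp add: cinner_diff_left)
    then show "(A o\<^sub>L proj S) x = A x"
      by (simp add: cinner_self_eq_0)
  qed
  then show "A \<in> Bplus S"
    using A sa by (simp add: Bplus_def B_sub_iff[OF assms] selfadjoint_def)
qed (simp add: Bplus_def B_sub_iff[OF assms])

lemma compression_in_Bplus:
  assumes "fin_dim_subspace S" and "positive_op \<rho>"
  shows "proj S o\<^sub>L \<rho> o\<^sub>L proj S \<in> Bplus S"
  using assms by (auto simp: Bplus_def B_sub_def positive_op_def cinner_proj[of S _ x for x]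
      intro!: bop_compose proj_in_bop)

lemma rank_one_positive: "positive_op (rank_one x x)"
proof -
  have "cinner z x * cinner x z = complex_of_real ((cmod (cinner z x))\<^sup>2)" for z
    unfolding complex_norm_square by (simp flip: cinner_commute)
  then have "cinner z x * cinner x z \<in> \<real>\<^sub>\<ge>\<^sub>0" for z
    by (simp only: nonneg_Reals_of_real_iff zero_le_power2)
  then show ?thesis
    by (simp add: positive_op_def rank_one_in_bop rank_one_apply cinner_scaleC_left)
qed

lemma rank_one_in_Bplus:
  assumes "fin_dim_subspace S" and "x \<in> S"
  shows "rank_one x x \<in> Bplus S"
  using assms
  by (auto simp: Bplus_iff rank_one_positive rank_one_apply bop_scaleC[OF proj_in_bop] proj_id
      intro!: blinfun_eqI)

text \<open>Expanding each \<open>f \<in> F\<close> in the basis and applying the continuous functional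
  \<open>x \<mapsto> \<langle>A x, f\<rangle>\<close> turns the diagonal series into a finite sum. For operators with range in a
  finite-dimensional subspace this gives summability and a trace that is visibly linear.\<close>

lemma has_sum_diag_entry:
  assumes e: "orthonormal_basis e" and A: "A \<in> bop"
    and range: "\<And>x. fourier_sum F (A x) = A x"
  shows "(diag_entry e A has_sum (\<Sum>f\<in>F. cinner (A f) f)) UNIV"
proof -
  have "bounded_linear (\<lambda>x. cinner (A x) f)" for f
    by (rule bounded_linear_compose[OF bounded_linear_cinner_left blinfun.bounded_linear_right])
  from has_sum_bounded_linear[OF this orthonormal_basis_expansion[OF e]]
  have "((\<lambda>n. cinner f (e n) * cinner (A (e n)) f) has_sum cinner (A f) f) UNIV" for f
    by (simp add: bop_scaleC[OF A] cinner_scaleC_left)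
  then have "((\<lambda>n. \<Sum>f\<in>F. cinner f (e n) * cinner (A (e n)) f) has_sum
      (\<Sum>f\<in>F. cinner (A f) f)) UNIV"
    by (induction F rule: infinite_finite_induct) (simp_all add: has_sum_add)
  moreover have "(\<Sum>f\<in>F. cinner f (e n) * cinner (A (e n)) f) = diag_entry e A n" for n
    using arg_cong[OF range[of "e n"], of "\<lambda>v. cinner v (e n)"]
    by (simp add: diag_entry_def fourier_sum_def cinner_sum_left cinner_scaleC_left mult.commute)
  ultimately show ?thesis
    by (simp add: fun_eq_iff cong: has_sum_cong)
qed

lemma ex_trace_basis:
  assumes "orthonormal_basis e" and "fin_dim_subspace S"
  shows "\<exists>F. \<forall>A\<in>bop. (\<forall>x. proj S (blinfun_apply A x) = A x) \<longrightarrow>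
           (diag_entry e A has_sum (\<Sum>f\<in>F. cinner (A f) f)) UNIV"
proof -
  obtain F where F: "\<And>x. proj S x = fourier_sum F x"
    using fin_dim_subspace_ex_basis[OF assms(2)] by blast
  show ?thesis
    using has_sum_diag_entry[OF assms(1), of _ F] by (intro exI[of _ F]) (simp add: F)
qed

lemma Bh_has_sum_trace:
  assumes "orthonormal_basis e" and "fin_dim_subspace S" and "A \<in> Bh S"
  shows "(diag_entry e A has_sum tr e A) UNIV"
proof -
  have "diag_entry e A summable_on UNIV"
    using ex_trace_basis[OF assms(1,2)] Bh_imp_bop[OF assms(3)] Bh_apply(1)[OF assms(2,3)]
    by (auto simp: summable_on_def)
  then show ?thesis
    by (simp add: tr_def)
qed

lemma Bplus_trace_class:
  assumes "orthonormal_basis e" and "fin_dim_subspace S" and "A \<in> Bplus S"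
  shows "A \<in> trace_class e"
proof -
  have "selfadjoint A" "positive_op A"
    using assms(3) by (simp_all add: Bplus_def positive_op_imp_selfadjoint)
  moreover have "diag_entry e A summable_on UNIV"
    using Bh_has_sum_trace[OF assms(1,2) Bplus_imp_Bh[OF assms(3)]] by (auto simp: summable_on_def)
  \<comment> \<open>a positive operator is its own adjoint and its own absolute value\<close>
  ultimately show ?thesis
    unfolding trace_class_def is_cadjoint_def selfadjoint_def by blast
qed

lemma density_set_eq:
  assumes "orthonormal_basis e" and "fin_dim_subspace S"
  shows "density_set e S = {A \<in> Bplus S. tr e A = 1}"
  using Bplus_trace_class[OF assms] by (auto simp: density_set_def Bplus_iff[OF assms(2)])

section \<open>The operators representing the diagonal entries\<close>

text \<open>Composing with the compression of \<open>E\<^sub>n\<close> gives a rank-one operator, so the trace is an inner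
  product. Only the compression of \<open>A\<close> enters, which lets density operators on the whole space be
  replaced by operators on \<open>S\<close>.\<close>

lemma trace_compressed:
  assumes "orthonormal_basis e" and "fin_dim_subspace S" and "A \<in> bop"
  shows "tr e (A o\<^sub>L compressed e S n) = diag_entry e (proj S o\<^sub>L A o\<^sub>L proj S) n"
proof -
  let ?p = "proj S (e n)"
  have "A o\<^sub>L compressed e S n = rank_one (A ?p) ?p"
    using assms(2,3)
    by (auto intro!: blinfun_eqI
        simp: compressed_def rank_one_apply bop_scaleC proj_in_bop cinner_proj)
  then show ?thesis
    by (simp add: trace_rank_one[OF assms(1)] diag_entry_def cinner_proj[OF assms(2)])
qed

lemma compressed_in_Bh:
  assumes "fin_dim_subspace S"
  shows "compressed e S n \<in> Bh S"
  unfolding compressed_def using compression_in_Bplus[OF assms rank_one_positive]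
  by (rule Bplus_imp_Bh)

lemma Bh_trace_compressed:
  assumes "orthonormal_basis e" and "fin_dim_subspace S" and "A \<in> Bh S"
  shows "tr e (A o\<^sub>L compressed e S n) = diag_entry e A n"
  using trace_compressed[OF assms(1,2) Bh_imp_bop[OF assms(3)]]
  by (simp add: diag_entry_def Bh_apply[OF assms(2,3)])

text \<open>Testing against the rank-one operators on \<open>S\<close> shows that the quadratic forms of two
  representing operators agree.\<close>

lemma entry_op_eq_compressed:
  assumes e: "orthonormal_basis e" and S: "fin_dim_subspace S"
  shows "entry_op e S n = compressed e S n"
  unfolding entry_op_def
proof (rule the_equality)
  show "compressed e S n \<in> Bh S \<and> (\<forall>A\<in>Bh S. tr e (A o\<^sub>L compressed e S n) = diag_entry e A n)"
    using compressed_in_Bh[OF S] Bh_trace_compressed[OF e S] by blast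
next
  fix T
  assume T: "T \<in> Bh S \<and> (\<forall>A\<in>Bh S. tr e (A o\<^sub>L T) = diag_entry e A n)"
  let ?C = "compressed e S n"
  have trace: "tr e (rank_one y y o\<^sub>L A) = cinner y (A y)" if "A \<in> Bh S" for A y
  proof -
    have "rank_one y y o\<^sub>L A = rank_one y (A y)"
      using that by (auto intro!: blinfun_eqI simp: rank_one_apply Bh_def selfadjointD)
    then show ?thesis
      by (simp add: trace_rank_one[OF e])
  qed
  have eq: "cinner y (T y) = cinner y (?C y)" if "y \<in> S" for y
  proof -
    have y: "rank_one y y \<in> Bh S"
      by (rule Bplus_imp_Bh[OF rank_one_in_Bplus[OF S that]])
    show ?thesis
      using T y Bh_trace_compressed[OF e S y, of n] trace[of T y] trace[OF compressed_in_Bh[OF S], of y]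
      by simp
  qed
  have sa: "selfadjoint T" "selfadjoint ?C"
    using T compressed_in_Bh[OF S] by (auto simp: Bh_def)
  have "T - ?C = 0"
  proof (rule selfadjoint_eq_0)
    show "selfadjoint (T - ?C)"
      using sa by (simp add: selfadjoint_def bop_diff blinfun.diff_left cinner_diff_left cinner_diff_right)
    fix x
    have form: "cinner (A x) x = cinner (proj S x) (A (proj S x))" if "A \<in> Bh S" for A
      using that Bh_apply[OF S that, of x] selfadjointD[of A x x] cinner_proj[OF S, of x "A x"]
      by (simp add: Bh_def)
    show "cinner ((T - ?C) x) x = 0"
      using form[of T] form[OF compressed_in_Bh[OF S]] eq[OF proj_in_subspace[OF S]] T
      by (simp add: blinfun.diff_left cinner_diff_left)
  qed
  then show "T = ?C"
    by simp
qed

lemma perp_entry_ops_iff: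
  assumes "orthonormal_basis e" and "fin_dim_subspace S" and "fin_dim_subspace V"
    and "X \<in> Bh S" and "Y \<in> Bh V"
  shows "perp e (X, - Y) (entry_op e S n, entry_op e V n) \<longleftrightarrow> diag_entry e X n = diag_entry e Y n"
proof -
  have "tr e (- Y o\<^sub>L compressed e V n) = - tr e (Y o\<^sub>L compressed e V n)"
    by (simp add: tr_def diag_entry_def blinfun.minus_left cinner_minus_left infsum_uminus)
  then show ?thesis
    using assms by (simp add: perp_def entry_op_eq_compressed Bh_trace_compressed)
qed

text \<open>The condition that \<open>(X, -Y)\<close> annihilates a pair is real linear in the pair, hence passes from
  a spanning family to the whole span.\<close>

lemma diag_entry_eq_if_eq_on_spanning:
  assumes e: "orthonormal_basis e" and S: "fin_dim_subspace S" and V: "fin_dim_subspace V"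
    and span: "span ((\<lambda>n. (entry_op e S n, entry_op e V n)) ` J) =
               span (range (\<lambda>n. (entry_op e S n, entry_op e V n)))"
    and X: "X \<in> Bh S" and Y: "Y \<in> Bh V"
    and eq: "\<And>n. n \<in> J \<Longrightarrow> diag_entry e X n = diag_entry e Y n"
  shows "diag_entry e X = diag_entry e Y"
proof
  fix n
  obtain F G
    where F: "\<forall>A\<in>bop. (\<forall>x. proj S (blinfun_apply A x) = A x) \<longrightarrow>
           (diag_entry e A has_sum (\<Sum>f\<in>F. cinner (A f) f)) UNIV"
      and G: "\<forall>A\<in>bop. (\<forall>x. proj V (blinfun_apply A x) = A x) \<longrightarrow>
           (diag_entry e A has_sum (\<Sum>g\<in>G. cinner (A g) g)) UNIV"
    using ex_trace_basis[OF e S] ex_trace_basis[OF e V] by blast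
  define U :: "(('a \<Rightarrow>\<^sub>L 'a) \<times> ('a \<Rightarrow>\<^sub>L 'a)) set" where
    "U = {(T, L). (\<Sum>f\<in>F. cinner (X (blinfun_apply T f)) f) = (\<Sum>g\<in>G. cinner (Y (blinfun_apply L g)) g)}"
  have U: "subspace U"
    by (rule subspaceI)
       (auto simp: U_def zero_prod_def blinfun.add_left blinfun.add_right blinfun.scaleR_left
         blinfun.scaleR_right cinner_add_left cinner_scaleR_left sum.distrib simp flip: sum_distrib_left)
  have mem: "(entry_op e S k, entry_op e V k) \<in> U \<longleftrightarrow> diag_entry e X k = diag_entry e Y k" for k
  proof -
    have "tr e (X o\<^sub>L compressed e S k) = (\<Sum>f\<in>F. cinner ((X o\<^sub>L compressed e S k) f) f)"
      unfolding tr_def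
      by (rule infsumI, rule F[rule_format])
         (simp_all add: bop_compose Bh_imp_bop[OF X] Bh_imp_bop[OF compressed_in_Bh[OF S]] Bh_apply(1)[OF S X])
    then have "diag_entry e X k = (\<Sum>f\<in>F. cinner (X (compressed e S k f)) f)"
      unfolding Bh_trace_compressed[OF e S X] blinfun_apply_blinfun_compose .
    moreover have "tr e (Y o\<^sub>L compressed e V k) = (\<Sum>g\<in>G. cinner ((Y o\<^sub>L compressed e V k) g) g)"
      unfolding tr_def
      by (rule infsumI, rule G[rule_format])
         (simp_all add: bop_compose Bh_imp_bop[OF Y] Bh_imp_bop[OF compressed_in_Bh[OF V]] Bh_apply(1)[OF V Y])
    then have "diag_entry e Y k = (\<Sum>g\<in>G. cinner (Y (compressed e V k g)) g)"
      unfolding Bh_trace_compressed[OF e V Y] blinfun_apply_blinfun_compose .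
    ultimately show ?thesis
      by (simp add: U_def entry_op_eq_compressed[OF e S] entry_op_eq_compressed[OF e V])
  qed
  have "span ((\<lambda>n. (entry_op e S n, entry_op e V n)) ` J) \<subseteq> U"
    using mem eq by (intro span_minimal U) auto
  moreover have "(entry_op e S n, entry_op e V n) \<in> span (range (\<lambda>n. (entry_op e S n, entry_op e V n)))"
    by (intro span_base) simp
  ultimately show "diag_entry e X n = diag_entry e Y n"
    using span mem by blast
qed

section \<open>The diagonal operator\<close>

text \<open>For an operator with summable diagonal the series of the rank-one operators
  \<open>d\<^sub>n (e\<^sub>n \<otimes> e\<^sub>n)\<close> converges absolutely in operator norm, which gives existence.\<close>

lemma Diag_apply_basis:
  assumes e: "orthonormal_basis e" and summ: "diag_entry e A summable_on UNIV"
  shows "Diag e A (e k) = diag_entry e A k *\<^sub>C e k"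
proof -
  let ?d = "diag_entry e A"
  let ?Q = "\<lambda>D :: 'a \<Rightarrow>\<^sub>L 'a. D \<in> bop \<and> (\<forall>n. D (e n) = ?d n *\<^sub>C e n)"
  have ee: "cinner (e i) (e j) = (if i = j then 1 else 0)" for i j
    using e by (simp add: orthonormal_basis_def)
  have norm_e: "norm (e n) = 1" for n
  proof -
    have "complex_of_real ((norm (e n))\<^sup>2) = complex_of_real 1"
      using ee[of n n] by (simp add: cinner_self)
    then have "(norm (e n))\<^sup>2 = 1"
      by (simp only: of_real_eq_iff)
    then show ?thesis
      by (simp add: power2_eq_1_iff) (smt (verit) norm_ge_zero)
  qed
  define R where "R n = rank_one (?d n *\<^sub>C e n) (e n)" for n
  have norm_R: "norm (R n) \<le> cmod (?d n)" for n
  proof (rule norm_blinfun_bound)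
    fix x
    have "norm (R n x) = cmod (cinner x (e n)) * cmod (?d n)"
      by (simp add: R_def rank_one_apply norm_scaleC norm_e norm_mult)
    also have "\<dots> \<le> norm x * cmod (?d n)"
      using norm_cinner_le[of x "e n"] by (intro mult_right_mono) (simp_all add: norm_e)
    finally show "norm (R n x) \<le> cmod (?d n) * norm x"
      by (simp add: mult.commute)
  qed simp
  have "summable (\<lambda>n. cmod (?d n))"
    using summ by (simp add: summable_on_iff_abs_summable_on_complex summable_on_UNIV_nonneg_real_iff)
  then have "summable R"
    by (rule summable_comparison_test') (rule norm_R)
  then have sums: "(\<lambda>n. R n x) sums suminf R x" for x
    by (intro bounded_linear.sums[OF blinfun.bounded_linear_left] summable_sums)
  have Q: "?Q (suminf R)"
  proof (intro conjI allI)
    have "suminf R (c *\<^sub>C x) = c *\<^sub>C suminf R x" for c x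
    proof (rule sums_unique2[OF sums])
      show "(\<lambda>n. R n (c *\<^sub>C x)) sums (c *\<^sub>C suminf R x)"
        using bounded_linear.sums[OF bounded_linear_scaleC_right sums, of c x]
        by (simp add: bop_scaleC[OF rank_one_in_bop] R_def)
    qed
    then show "suminf R \<in> bop"
      by (simp add: bop_def)
    fix n
    have "(\<lambda>i. R i (e n)) sums (?d n *\<^sub>C e n)"
      using sums_single[of n "\<lambda>i. ?d i *\<^sub>C e i"]
      by (rule sums_cong[THEN iffD1, rotated]) (auto simp: R_def rank_one_apply ee)
    with sums show "suminf R (e n) = ?d n *\<^sub>C e n"
      by (rule sums_unique2)
  qed
  moreover have "D = suminf R" if D: "?Q D" for D
  proof (rule blinfun_eqI)
    fix x
    have image: "((\<lambda>n. cinner x (e n) *\<^sub>C ?d n *\<^sub>C e n) has_sum B x) UNIV" if "?Q B" for B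
      using has_sum_bounded_linear[OF blinfun.bounded_linear_right[of B] orthonormal_basis_expansion[OF e, of x]]
        that by (simp add: bop_scaleC)
    show "D x = suminf R x"
      using image[OF D] image[OF Q] by (rule has_sum_unique)
  qed
  ultimately have "?Q (Diag e A)"
    unfolding Diag_def by (rule theI)
  then show ?thesis
    by blast
qed

lemma Diag_eq_iff:
  assumes "orthonormal_basis e"
    and "diag_entry e A summable_on UNIV" and "diag_entry e B summable_on UNIV"
  shows "Diag e A = Diag e B \<longleftrightarrow> diag_entry e A = diag_entry e B"
proof
  assume eq: "Diag e A = Diag e B"
  show "diag_entry e A = diag_entry e B"
  proof
    fix n
    have "cinner (diag_entry e A n *\<^sub>C e n) (e n) = cinner (diag_entry e B n *\<^sub>C e n) (e n)"
      by (simp only: flip: Diag_apply_basis[OF assms(1,2)] Diag_apply_basis[OF assms(1,3)]) (simp add: eq)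
    then show "diag_entry e A n = diag_entry e B n"
      using assms(1) by (simp add: cinner_scaleC_left orthonormal_basis_def)
  qed
qed (simp add: Diag_def)

section \<open>Joint numerical ranges of the compressions\<close>

lemma joint_range_compressed:
  assumes "orthonormal_basis e" and "fin_dim_subspace S"
  shows "joint_range e J (compressed e S) =
    {(\<lambda>j\<in>J. diag_entry e (proj S o\<^sub>L \<rho> o\<^sub>L proj S) j) | \<rho>.
       \<rho> \<in> trace_class e \<and> positive_op \<rho> \<and> tr e \<rho> = 1}"
proof -
  have "tr e (\<rho> o\<^sub>L compressed e S j) = diag_entry e (proj S o\<^sub>L \<rho> o\<^sub>L proj S) j"
    if "positive_op \<rho>" for \<rho> j
    using that by (intro trace_compressed assms) (simp add: positive_op_def)
  then show ?thesis
    unfolding joint_range_def by (intro Collect_cong ex_cong1 iffI; elim conjE; simp)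
qed

lemma diag_entry_in_joint_range:
  assumes e: "orthonormal_basis e" and S: "fin_dim_subspace S"
    and X: "X \<in> Bplus S" "tr e X = 1"
  shows "(\<lambda>j\<in>J. diag_entry e X j) \<in> joint_range e J (compressed e S)"
proof -
  have "proj S o\<^sub>L X o\<^sub>L proj S = X"
    using X(1) by (simp add: Bplus_def B_sub_iff[OF S])
  then show ?thesis
    using X Bplus_trace_class[OF e S X(1)] unfolding joint_range_compressed[OF e S]
    by (auto simp: Bplus_def intro!: exI[of _ X])
qed

lemma diag_entry_nonneg: "positive_op A \<Longrightarrow> diag_entry e A n \<in> \<real>\<^sub>\<ge>\<^sub>0"
  by (simp add: positive_op_def diag_entry_def)

text \<open>A density operator concentrated on a unit vector of \<open>V\<close> is invisible to the compressions to \<open>S\<close>.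
  So the zero family always lies in the joint range.\<close>

lemma zero_in_joint_range:
  assumes e: "orthonormal_basis e" and S: "fin_dim_subspace S" and V: "fin_dim_subspace V"
    and "V \<noteq> {0}" and orth: "\<forall>x\<in>S. \<forall>y\<in>V. cinner x y = 0"
  shows "(\<lambda>j\<in>J. 0) \<in> joint_range e J (compressed e S)"
proof -
  have V_sub: "complex_vector.subspace V"
    using V complex_vector.subspace_span by (auto simp: fin_dim_subspace_def)
  then obtain v where v: "v \<in> V" "v \<noteq> 0"
    using \<open>V \<noteq> {0}\<close> complex_vector.subspace_0 by blast
  define u where "u = complex_of_real (1 / norm v) *\<^sub>C v"
  have u: "u \<in> V" "norm u = 1"
    using v V_sub by (simp_all add: u_def complex_vector.subspace_scale norm_scaleC norm_divide)
  let ?\<rho> = "rank_one u u"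
  have \<rho>: "?\<rho> \<in> trace_class e" "positive_op ?\<rho>" "tr e ?\<rho> = 1"
    using Bplus_trace_class[OF e V rank_one_in_Bplus[OF V u(1)]]
    by (simp_all add: rank_one_positive trace_rank_one[OF e] cinner_self u(2))
  have "cinner (proj S x) u = 0" for x
    using orth u(1) proj_in_subspace[OF S] by blast
  then have "diag_entry e (proj S o\<^sub>L ?\<rho> o\<^sub>L proj S) j = 0" for j
    by (simp add: diag_entry_def rank_one_apply)
  then show ?thesis
    unfolding joint_range_compressed[OF e S] using \<rho> by (auto intro!: exI[of _ ?\<rho>])
qed

text \<open>The diagonal entries of a positive operator are nonnegative reals, so a single nonzero one bounds
  the trace away from zero.\<close>

lemma trace_positive_if_diag_entry_nonzero:
  assumes "positive_op A" and "(diag_entry e A has_sum t) UNIV" and "diag_entry e A n \<noteq> 0"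
  shows "\<exists>r>0. t = complex_of_real r"
proof -
  have real: "Im (diag_entry e A k) = 0" and nonneg: "Re (diag_entry e A k) \<ge> 0" for k
    using diag_entry_nonneg[OF assms(1), of e k] by (simp_all add: complex_nonneg_Reals_iff)
  have "Im t = 0"
    using has_sum_Im[OF assms(2)] has_sum_unique[OF _ has_sum_0_simp] by (simp add: real)
  moreover have "Re (diag_entry e A n) \<le> Re t"
    using finite_sum_le_has_sum[OF has_sum_Re[OF assms(2)], of "{n}"] nonneg by simp
  moreover have "Re (diag_entry e A n) > 0"
    using real[of n] nonneg[of n] assms(3) by (simp add: complex_eq_iff order_less_le)
  ultimately show ?thesis
    by (intro exI[of _ "Re t"]) (simp add: complex_eq_iff)
qed

lemma scaleR_in_Bplus:
  assumes S: "fin_dim_subspace S" and A: "A \<in> Bplus S" and "r \<ge> 0"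
  shows "r *\<^sub>R A \<in> Bplus S"
proof -
  have "A \<in> bop" "\<And>x. cinner (A x) x \<in> \<real>\<^sub>\<ge>\<^sub>0"
    using A by (simp_all add: Bplus_def positive_op_def)
  then have "positive_op (r *\<^sub>R A)"
    using \<open>r \<ge> 0\<close>
    by (auto simp: positive_op_def bop_def blinfun.scaleR_left cinner_scaleC_left scaleR_scaleC
        scaleC_scaleC mult.commute intro!: nonneg_Reals_mult_I)
  moreover have "proj S o\<^sub>L r *\<^sub>R A = r *\<^sub>R A"
    using Bh_apply(1)[OF S Bplus_imp_Bh[OF A]]
    by (intro blinfun_eqI) (simp add: blinfun.scaleR_left blinfun.scaleR_right)
  ultimately show ?thesis
    by (simp add: Bplus_iff[OF S])
qed

text \<open>A common element of both joint ranges comes from two compressed density operators whose traces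
  may be smaller than one. By \<open>det\<close> their full diagonals agree. If the element is nonzero, the common
  trace is positive, and both operators can be normalized by the same factor.\<close>

lemma joint_ranges_meet_iff:
  assumes e: "orthonormal_basis e" and S: "fin_dim_subspace S" and V: "fin_dim_subspace V"
    and "S \<noteq> {0}" and "V \<noteq> {0}" and orth: "\<forall>x\<in>S. \<forall>y\<in>V. cinner x y = 0"
    and det: "\<And>X Y. X \<in> Bh S \<Longrightarrow> Y \<in> Bh V \<Longrightarrow>
                (\<And>n. n \<in> J \<Longrightarrow> diag_entry e X n = diag_entry e Y n) \<Longrightarrow> diag_entry e X = diag_entry e Y"
  shows "joint_range e J (compressed e S) \<inter> joint_range e J (compressed e V) \<noteq> {\<lambda>j\<in>J. 0} \<longleftrightarrow>
    (\<exists>X\<in>Bplus S. \<exists>Y\<in>Bplus V. tr e X = 1 \<and> tr e Y = 1 \<and> diag_entry e X = diag_entry e Y)"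
    (is "?I \<noteq> _ \<longleftrightarrow> ?core")
proof
  assume core: ?core
  then obtain X Y where X: "X \<in> Bplus S" "tr e X = 1" and Y: "Y \<in> Bplus V" "tr e Y = 1"
    and eq: "diag_entry e X = diag_entry e Y"
    by blast
  let ?z = "\<lambda>j\<in>J. diag_entry e X j"
  have "?z \<in> ?I"
    using diag_entry_in_joint_range[OF e S X, of J] diag_entry_in_joint_range[OF e V Y, of J]
    by (simp add: eq)
  moreover have "?z \<noteq> (\<lambda>j\<in>J. 0)"
  proof
    \<comment> \<open>otherwise \<open>X\<close> would agree on \<open>J\<close>, hence everywhere, with the zero operator on \<open>V\<close>\<close>
    assume "?z = (\<lambda>j\<in>J. 0)"
    then have "diag_entry e X n = 0" if "n \<in> J" for n
      using that by (metis restrict_apply')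
    moreover have "0 \<in> Bplus V"
      by (simp add: Bplus_iff[OF V] positive_op_def bop_def)
    ultimately have "diag_entry e X = diag_entry e 0"
      using X(1) by (intro det Bplus_imp_Bh) (simp_all add: diag_entry_def)
    then have "tr e X = 0"
      by (simp add: tr_def diag_entry_def)
    then show False
      using X(2) by simp
  qed
  ultimately show "?I \<noteq> {\<lambda>j\<in>J. 0}"
    by blast
next
  assume "?I \<noteq> {\<lambda>j\<in>J. 0}"
  moreover have "(\<lambda>j\<in>J. 0) \<in> ?I"
    using zero_in_joint_range[OF e S V \<open>V \<noteq> {0}\<close> orth, of J]
      zero_in_joint_range[OF e V S \<open>S \<noteq> {0}\<close>, of J] orth
    by (metis IntI cinner_commute complex_cnj_zero)
  ultimately obtain z where z: "z \<in> ?I" "z \<noteq> (\<lambda>j\<in>J. 0)"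
    by blast
  obtain \<rho> where \<rho>: "positive_op \<rho>" "z = (\<lambda>j\<in>J. diag_entry e (proj S o\<^sub>L \<rho> o\<^sub>L proj S) j)"
    using z(1) unfolding joint_range_compressed[OF e S] by blast
  obtain \<sigma> where \<sigma>: "positive_op \<sigma>" "z = (\<lambda>j\<in>J. diag_entry e (proj V o\<^sub>L \<sigma> o\<^sub>L proj V) j)"
    using z(1) unfolding joint_range_compressed[OF e V] by blast
  define X where "X = proj S o\<^sub>L \<rho> o\<^sub>L proj S"
  define Y where "Y = proj V o\<^sub>L \<sigma> o\<^sub>L proj V"
  have X: "X \<in> Bplus S" and Y: "Y \<in> Bplus V"
    unfolding X_def Y_def by (intro compression_in_Bplus S V \<rho>(1) \<sigma>(1))+
  have zX: "z j = diag_entry e X j" and zY: "z j = diag_entry e Y j" if "j \<in> J" for j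
    using fun_cong[OF \<rho>(2), of j] fun_cong[OF \<sigma>(2), of j] that by (simp_all add: X_def Y_def)
  have eq: "diag_entry e X = diag_entry e Y"
    using X Y zX zY by (intro det Bplus_imp_Bh) metis+
  obtain n where "n \<in> J" "z n \<noteq> 0"
    using z(2) \<rho>(2) by (auto simp: fun_eq_iff split: if_splits)
  then have "diag_entry e X n \<noteq> 0"
    by (simp add: zX)
  moreover have "positive_op X"
    using X by (simp add: Bplus_def)
  ultimately obtain r where r: "r > 0" "tr e X = complex_of_real r"
    using trace_positive_if_diag_entry_nonzero[OF _ Bh_has_sum_trace[OF e S Bplus_imp_Bh[OF X]]] by blast
  have scale: "diag_entry e (inverse r *\<^sub>R A) k = complex_of_real (inverse r) * diag_entry e A k" for A k
    by (simp only: diag_entry_def blinfun.scaleR_left cinner_scaleR_left)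
  have "tr e (inverse r *\<^sub>R A) = complex_of_real (inverse r) * tr e A" for A
    unfolding tr_def scale by (rule infsum_cmult_right')
  moreover have "tr e Y = tr e X"
    by (simp add: tr_def eq)
  ultimately have "tr e (inverse r *\<^sub>R X) = 1" "tr e (inverse r *\<^sub>R Y) = 1"
    using r by simp_all
  moreover have "diag_entry e (inverse r *\<^sub>R X) = diag_entry e (inverse r *\<^sub>R Y)"
    by (rule ext) (simp only: scale eq)
  ultimately show ?core
    using scaleR_in_Bplus[OF S X, of "inverse r"] scaleR_in_Bplus[OF V Y, of "inverse r"] r(1)
    by (meson inverse_nonnegative_iff_nonnegative less_imp_le)
qed

section \<open>The equivalences\<close>

theorem proposition12:
  fixes e :: "nat \<Rightarrow> 'a::complex_hilbert" and S V :: "'a set" and m :: nat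
  assumes "orthonormal_basis e"
    and "fin_dim_subspace S" and "S \<noteq> {0}"
    and "fin_dim_subspace V" and "V \<noteq> {0}"
    and "\<forall>x\<in>S. \<forall>y\<in>V. cinner x y = 0"
    and "inj_on (\<lambda>n. (entry_op e S n, entry_op e V n)) {..<m}"
    and "independent ((\<lambda>n. (entry_op e S n, entry_op e V n)) ` {..<m})"
    and "span ((\<lambda>n. (entry_op e S n, entry_op e V n)) ` {..<m}) =
         span (range (\<lambda>n. (entry_op e S n, entry_op e V n)))"
  shows "all_equivalent [
    (\<exists>X Y. (X, Y) \<in> Bplus S \<times> Bplus V \<and> (X, Y) \<noteq> 0 \<and> tr e X = 1 \<and> tr e Y = 1 \<and>
       (X, Y) \<in> ker_Delta e S V),
    (\<exists>X Y. (X, Y) \<in> Bplus S \<times> Bplus V \<and> (X, Y) \<noteq> 0 \<and> tr e X = 1 \<and> tr e Y = 1 \<and>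
       (\<forall>n<m. perp e (X, - Y) (entry_op e S n, entry_op e V n))),
    (\<exists>X Y. (X, Y) \<in> Bplus S \<times> Bplus V \<and> (X, Y) \<noteq> 0 \<and> tr e X = 1 \<and> tr e Y = 1 \<and>
       (\<forall>n. perp e (X, - Y) (entry_op e S n, entry_op e V n))),
    (\<exists>X Y. (X, Y) \<in> Bplus S \<times> Bplus V \<and> (X, Y) \<noteq> 0 \<and> tr e X = 1 \<and> tr e Y = 1 \<and>
       (\<forall>n<m. diag_entry e X n = diag_entry e Y n)),
    (\<exists>X Y. (X, Y) \<in> Bplus S \<times> Bplus V \<and> (X, Y) \<noteq> 0 \<and> tr e X = 1 \<and> tr e Y = 1 \<and>
       Diag e X = Diag e Y),
    moment_set e S \<inter> moment_set e V \<noteq> {},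
    joint_range e UNIV (compressed e S) \<inter> joint_range e UNIV (compressed e V) \<noteq> {\<lambda>j\<in>UNIV. 0},
    joint_range e {..<m} (compressed e S) \<inter> joint_range e {..<m} (compressed e V)
      \<noteq> {\<lambda>j\<in>{..<m}. 0}]"
proof -
  note e = assms(1) and S = assms(2) and V = assms(4)
  define core where "core \<longleftrightarrow>
    (\<exists>X\<in>Bplus S. \<exists>Y\<in>Bplus V. tr e X = 1 \<and> tr e Y = 1 \<and> diag_entry e X = diag_entry e Y)"
  let ?pair = "\<lambda>Q. \<exists>X Y. (X, Y) \<in> Bplus S \<times> Bplus V \<and> (X, Y) \<noteq> 0 \<and> tr e X = 1 \<and> tr e Y = 1 \<and> Q X Y"
  have tr0: "tr e 0 \<noteq> 1"
    by (simp add: tr_def diag_entry_def)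
  have pair: "?pair Q \<longleftrightarrow> core"
    if Q: "\<And>X Y. X \<in> Bh S \<Longrightarrow> Y \<in> Bh V \<Longrightarrow> Q X Y \<longleftrightarrow> diag_entry e X = diag_entry e Y" for Q
  proof
    assume "?pair Q"
    then show core
      unfolding core_def using Q Bplus_imp_Bh by blast
  next
    assume core
    then obtain X Y where "X \<in> Bplus S" "Y \<in> Bplus V" "tr e X = 1" "tr e Y = 1"
        "diag_entry e X = diag_entry e Y"
      unfolding core_def by blast
    moreover from this have "(X, Y) \<noteq> 0"
      using tr0 by (auto simp: zero_prod_def)
    ultimately show "?pair Q"
      using Q Bplus_imp_Bh by blast
  qed
  have det: "diag_entry e X = diag_entry e Y"
    if "X \<in> Bh S" "Y \<in> Bh V" "\<And>n. n \<in> {..<m} \<Longrightarrow> diag_entry e X n = diag_entry e Y n" for X Y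
    by (rule diag_entry_eq_if_eq_on_spanning[OF e S V assms(9) that])
  have initial: "(\<forall>n<m. diag_entry e X n = diag_entry e Y n) \<longleftrightarrow> diag_entry e X = diag_entry e Y"
    if "X \<in> Bh S" "Y \<in> Bh V" for X Y
    using det[OF that] by auto
  have Diag: "Diag e X = Diag e Y \<longleftrightarrow> diag_entry e X = diag_entry e Y"
    if "X \<in> Bh S" "Y \<in> Bh V" for X Y
    using Bh_has_sum_trace[OF e S that(1)] Bh_has_sum_trace[OF e V that(2)]
    by (intro Diag_eq_iff e) (auto simp: summable_on_def)
  have 1: "?pair (\<lambda>X Y. (X, Y) \<in> ker_Delta e S V) \<longleftrightarrow> core"
    by (rule pair) (simp add: ker_Delta_def Diag)
  have 2: "?pair (\<lambda>X Y. \<forall>n<m. perp e (X, - Y) (entry_op e S n, entry_op e V n)) \<longleftrightarrow> core"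
    by (rule pair) (simp add: perp_entry_ops_iff[OF e S V] initial)
  have 3: "?pair (\<lambda>X Y. \<forall>n. perp e (X, - Y) (entry_op e S n, entry_op e V n)) \<longleftrightarrow> core"
    by (rule pair) (simp add: perp_entry_ops_iff[OF e S V] fun_eq_iff)
  have 4: "?pair (\<lambda>X Y. \<forall>n<m. diag_entry e X n = diag_entry e Y n) \<longleftrightarrow> core"
    by (rule pair) (rule initial)
  have 5: "?pair (\<lambda>X Y. Diag e X = Diag e Y) \<longleftrightarrow> core"
    by (rule pair) (rule Diag)
  have 6: "moment_set e S \<inter> moment_set e V \<noteq> {} \<longleftrightarrow> core"
    unfolding moment_set_def density_set_eq[OF e S] density_set_eq[OF e V] core_def by blast
  have 7: "joint_range e UNIV (compressed e S) \<inter> joint_range e UNIV (compressed e V)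
      \<noteq> {\<lambda>j\<in>UNIV. 0} \<longleftrightarrow> core"
    unfolding core_def by (rule joint_ranges_meet_iff[OF e S V assms(3,5,6)]) auto
  have 8: "joint_range e {..<m} (compressed e S) \<inter> joint_range e {..<m} (compressed e V)
      \<noteq> {\<lambda>j\<in>{..<m}. 0} \<longleftrightarrow> core"
    unfolding core_def by (rule joint_ranges_meet_iff[OF e S V assms(3,5,6) det])
  show ?thesis
    unfolding 1 2 3 4 5 6 7 8 by (simp add: all_equivalent_def)
qed

end
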